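(* Let $A_1,A_2\in\mathbb{R}^{m\times n}$ and let $A_1=U_1-V$ and $A_2=U_2-V$ be two proper weak regular splittings of different types (one of type I and the other of type II). Suppose that $\rho(U_1^{\dagger}V)>0$ and $\rho(U_2^{\dagger}V)>0$. If $V\neq 0$ and $A_2^{\dagger}>A_1^{\dagger}\geq 0$, then $\rho(U_1^{\dagger}V)<\rho(U_2^{\dagger}V)<1$.
   Context: $A^{\dagger}$ denotes the Moore–Penrose inverse and $\rho(\cdot)$ the spectral radius. Inequalities between matrices are entrywise; $X>Y$ means every entry of $X-Y$ is positive. A splitting $A=U-V$ is proper if $R(U)=R(A)$ and $N(U)=N(A)$. A proper splitting is a proper weak regular splitting of type I if $U^{\dagger}\geq 0$ and $U^{\dagger}V\geq 0$, and of type II if $U^{\dagger}\geq 0$ and $VU^{\dagger}\geq 0$. *)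

theory Defs
  imports "Jordan_Normal_Form.Spectral_Radius"
begin

definition is_mp_inverse :: "real mat \<Rightarrow> real mat \<Rightarrow> bool" where
  "is_mp_inverse A X \<longleftrightarrow> X \<in> carrier_mat (dim_col A) (dim_row A) \<and>
     A * X * A = A \<and> X * A * X = X \<and>
     transpose_mat (A * X) = A * X \<and> transpose_mat (X * A) = X * A"

text \<open>Moore-Penrose inverse (exists and is unique for real matrices).\<close>
definition mp_inverse :: "real mat \<Rightarrow> real mat" where
  "mp_inverse A = (SOME X. is_mp_inverse A X)"

definition spec_rad :: "real mat \<Rightarrow> real" where
  "spec_rad A = spectral_radius (map_mat complex_of_real A)"

definition range_mat :: "real mat \<Rightarrow> real vec set" where
  "range_mat A = {mult_mat_vec A x | x. x \<in> carrier_vec (dim_col A)}"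

definition null_mat :: "real mat \<Rightarrow> real vec set" where
  "null_mat A = {x \<in> carrier_vec (dim_col A). mult_mat_vec A x = 0\<^sub>v (dim_row A)}"

definition nonneg_mat :: "real mat \<Rightarrow> bool" where
  "nonneg_mat A \<longleftrightarrow> (\<forall>i < dim_row A. \<forall>j < dim_col A. A $$ (i, j) \<ge> 0)"

definition pos_mat :: "real mat \<Rightarrow> bool" where
  "pos_mat A \<longleftrightarrow> (\<forall>i < dim_row A. \<forall>j < dim_col A. A $$ (i, j) > 0)"

definition proper_splitting :: "real mat \<Rightarrow> real mat \<Rightarrow> real mat \<Rightarrow> bool" where
  "proper_splitting A U V \<longleftrightarrow> A = U - V \<and> range_mat U = range_mat A \<and> null_mat U = null_mat A"

definition pwr_splitting_I :: "real mat \<Rightarrow> real mat \<Rightarrow> real mat \<Rightarrow> bool" where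
  "pwr_splitting_I A U V \<longleftrightarrow> proper_splitting A U V \<and>
     nonneg_mat (mp_inverse U) \<and> nonneg_mat (mp_inverse U * V)"

definition pwr_splitting_II :: "real mat \<Rightarrow> real mat \<Rightarrow> real mat \<Rightarrow> bool" where
  "pwr_splitting_II A U V \<longleftrightarrow> proper_splitting A U V \<and>
     nonneg_mat (mp_inverse U) \<and> nonneg_mat (V * mp_inverse U)"

end

theory Submission
  imports Defs
begin

text \<open>Both splittings give \<open>U\<^sub>i\<^sup>\<dagger> = A\<^sub>i\<^sup>\<dagger> - U\<^sub>i\<^sup>\<dagger> V A\<^sub>i\<^sup>\<dagger> = A\<^sub>i\<^sup>\<dagger> - A\<^sub>i\<^sup>\<dagger> V U\<^sub>i\<^sup>\<dagger>\<close>, because \<open>A\<^sub>i\<close> and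
  \<open>U\<^sub>i\<close> have the same range and null space projections. With \<open>\<rho>\<^sub>i = \<rho>(U\<^sub>i\<^sup>\<dagger> V)\<close> and
  \<open>\<mu>\<^sub>i = \<rho>\<^sub>i / (1 - \<rho>\<^sub>i)\<close>, say \<open>i\<close> is the type I and \<open>j\<close> the type II index. A left Perron vector
  \<open>w\<close> of \<open>U\<^sub>i\<^sup>\<dagger> V\<close> satisfies \<open>w\<^sup>T A\<^sub>i\<^sup>\<dagger> V = \<mu>\<^sub>i w\<^sup>T\<close>, a right Perron vector \<open>z\<close> of \<open>V U\<^sub>j\<^sup>\<dagger>\<close>
  satisfies \<open>V A\<^sub>j\<^sup>\<dagger> z = \<mu>\<^sub>j z\<close>, and nonnegativity forces \<open>\<rho>\<^sub>i, \<rho>\<^sub>j < 1\<close>. Evaluating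
  \<open>w\<^sup>T A\<^sub>i\<^sup>\<dagger> V A\<^sub>j\<^sup>\<dagger> z\<close> in two ways gives \<open>\<mu>\<^sub>i w\<^sup>T A\<^sub>j\<^sup>\<dagger> z = \<mu>\<^sub>j w\<^sup>T A\<^sub>i\<^sup>\<dagger> z\<close>, and
  \<open>A\<^sub>2\<^sup>\<dagger> > A\<^sub>1\<^sup>\<dagger>\<close> makes this \<open>\<mu>\<^sub>1 < \<mu>\<^sub>2\<close>.\<close>

subsection \<open>Existence of the Moore-Penrose inverse\<close>

lemma mult_mat_assoc_dim:
  fixes A B C :: "'a :: semiring_0 mat"
  assumes "dim_col A = dim_row B" "dim_col B = dim_row C"
  shows "A * B * C = A * (B * C)"
  by (rule assoc_mult_mat[of _ "dim_row A" "dim_row B" _ "dim_row C" _ "dim_col C"])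
    (use assms in auto)

lemma minus_mat_eq_zero_iff:
  fixes A B :: "'a :: group_add mat"
  assumes "A \<in> carrier_mat m n" "B \<in> carrier_mat m n"
  shows "A - B = 0\<^sub>m m n \<longleftrightarrow> A = B"
proof
  assume eq: "A - B = 0\<^sub>m m n"
  show "A = B"
  proof (rule eq_matI)
    fix i j assume "i < dim_row B" "j < dim_col B"
    then have "A $$ (i, j) - B $$ (i, j) = (A - B) $$ (i, j)" using assms by simp
    then show "A $$ (i, j) = B $$ (i, j)"
      using \<open>i < dim_row B\<close> \<open>j < dim_col B\<close> assms by (simp add: eq)
  qed (use assms in auto)
qed (use assms in auto)

text \<open>Wedderburn's rank reduction: for a pivot \<open>a = A\<^sub>i\<^sub>j\<close> and \<open>M = e\<^sub>j e\<^sub>i\<^sup>T / a\<close>, the matrix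
  \<open>A' = A - A M A\<close> has fewer nonzero rows, and a 1-inverse of \<open>A'\<close> lifts to one of \<open>A\<close>.\<close>

lemma ginverse_exists:
  fixes A :: "real mat"
  assumes "A \<in> carrier_mat m n"
  shows "\<exists>G \<in> carrier_mat n m. A * G * A = A"
  using assms
proof (induction "card {k. k < m \<and> (\<exists>l<n. A $$ (k, l) \<noteq> 0)}" arbitrary: A rule: less_induct)
  case less
  note A = less.prems
  show ?case
  proof (cases "\<exists>i<m. \<exists>j<n. A $$ (i, j) \<noteq> 0")
    case False
    then have "A = 0\<^sub>m m n" using A by (intro eq_matI) auto
    then have "A * 0\<^sub>m n m * A = A" by auto
    then show ?thesis by (intro bexI[of _ "0\<^sub>m n m"]) auto
  next
    case True
    then obtain i j where i: "i < m" and j: "j < n" and a: "A $$ (i, j) \<noteq> 0" by blast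
    define M where "M = mat n m (\<lambda>(k, l). if k = j \<and> l = i then 1 / A $$ (i, j) else 0)"
    have M: "M \<in> carrier_mat n m" by (simp add: M_def)
    have MA: "(M * A) $$ (k, l) = (if k = j then A $$ (i, l) / A $$ (i, j) else 0)"
      if "k < n" "l < n" for k l
    proof -
      have "(M * A) $$ (k, l) = (\<Sum>p = 0..<m. M $$ (k, p) * A $$ (p, l))"
        using that A M by (auto simp: scalar_prod_def)
      also have "\<dots> = (\<Sum>p = 0..<m. if p = i then (if k = j then A $$ (i, l) / A $$ (i, j) else 0) else 0)"
        using that by (intro sum.cong) (auto simp: M_def)
      finally show ?thesis using i by simp
    qed
    have AMA: "(A * (M * A)) $$ (k, l) = A $$ (k, j) * A $$ (i, l) / A $$ (i, j)"
      if "k < m" "l < n" for k l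
    proof -
      have "(A * (M * A)) $$ (k, l) = (\<Sum>p = 0..<n. A $$ (k, p) * (M * A) $$ (p, l))"
        using that A M by (auto simp: scalar_prod_def)
      also have "\<dots> = (\<Sum>p = 0..<n. if p = j then A $$ (k, j) * A $$ (i, l) / A $$ (i, j) else 0)"
        using that MA by (intro sum.cong) auto
      finally show ?thesis using j by simp
    qed
    define A' where "A' = A - A * (M * A)"
    have A': "A' \<in> carrier_mat m n" using A M by (auto simp: A'_def)
    have A'_index: "A' $$ (k, l) = A $$ (k, l) - A $$ (k, j) * A $$ (i, l) / A $$ (i, j)"
      if "k < m" "l < n" for k l
      using that A M AMA[OF that] by (simp add: A'_def)
    \<comment> \<open>By \<open>A'_index\<close>, row \<open>i\<close> of \<open>A'\<close>
      vanishes, while a zero row of \<open>A\<close> stays zero because \<open>A $$ (k, j)\<close>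
      is one of its entries.\<close>
    have "{k. k < m \<and> (\<exists>l<n. A' $$ (k, l) \<noteq> 0)} \<subset> {k. k < m \<and> (\<exists>l<n. A $$ (k, l) \<noteq> 0)}"
    proof (rule psubsetI)
      show "{k. k < m \<and> (\<exists>l<n. A' $$ (k, l) \<noteq> 0)} \<subseteq> {k. k < m \<and> (\<exists>l<n. A $$ (k, l) \<noteq> 0)}"
      proof clarify
        fix k l assume "k < m" "l < n" "A' $$ (k, l) \<noteq> 0"
        then have "A $$ (k, l) \<noteq> 0 \<or> A $$ (k, j) \<noteq> 0" using A'_index by auto
        then show "\<exists>l<n. A $$ (k, l) \<noteq> 0" using \<open>l < n\<close> j by blast
      qed
      have "i \<in> {k. k < m \<and> (\<exists>l<n. A $$ (k, l) \<noteq> 0)}" using i j a by auto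
      moreover have "i \<notin> {k. k < m \<and> (\<exists>l<n. A' $$ (k, l) \<noteq> 0)}" using A'_index i a by auto
      ultimately show "{k. k < m \<and> (\<exists>l<n. A' $$ (k, l) \<noteq> 0)} \<noteq> {k. k < m \<and> (\<exists>l<n. A $$ (k, l) \<noteq> 0)}"
        by blast
    qed
    then have "card {k. k < m \<and> (\<exists>l<n. A' $$ (k, l) \<noteq> 0)} < card {k. k < m \<and> (\<exists>l<n. A $$ (k, l) \<noteq> 0)}"
      by (intro psubset_card_mono) auto
    from less.hyps[OF this A'] obtain G' where G': "G' \<in> carrier_mat n m" and G'1: "A' * G' * A' = A'"
      by blast
    \<comment> \<open>These factors satisfy A L = R A = A', so A (L G' R) A = A' G' A' = A'; adding
      \<open>M\<close> restores the subtracted A M A.\<close>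
    define L where "L = 1\<^sub>m n - M * A"
    define R where "R = 1\<^sub>m m - A * M"
    have L: "L \<in> carrier_mat n n" and R: "R \<in> carrier_mat m m"
      using A M by (auto simp: L_def R_def)
    have AL: "A * L = A'" unfolding L_def A'_def
      by (subst mult_minus_distrib_mat[of _ m n]) (use A M in auto)
    have RA: "R * A = A'" unfolding R_def A'_def
      by (subst minus_mult_distrib_mat[of _ m m]) (use A M in auto)
    have LGR: "L * G' * R \<in> carrier_mat n m" using L G' R by auto
    have "A * (L * G' * R + M) * A = A * (L * G' * R) * A + A * M * A"
      using A M LGR by (simp add: mult_add_distrib_mat[of _ m n] add_mult_distrib_mat[of _ m m])
    also have "A * (L * G' * R) * A = (A * L) * G' * (R * A)"
      using A L G' R by (simp add: mult_mat_assoc_dim)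
    also have "\<dots> = A'" by (simp add: AL RA G'1)
    also have "A' + A * M * A = A"
      using A M by (intro eq_matI) (auto simp: A'_def)
    finally have "A * (L * G' * R + M) * A = A" .
    then show ?thesis using LGR M by (intro bexI[of _ "L * G' * R + M"]) auto
  qed
qed

section \<open>Gram matrices and orthogonal projections\<close>

lemma transpose_mult_self_eq_zero:
  fixes A :: "real mat"
  assumes A: "A \<in> carrier_mat m n" and 0: "transpose_mat A * A = 0\<^sub>m n n"
  shows "A = 0\<^sub>m m n"
proof (rule eq_matI)
  fix i j assume "i < dim_row (0\<^sub>m m n :: real mat)" "j < dim_col (0\<^sub>m m n :: real mat)"
  then have i: "i < m" and j: "j < n" by auto
  \<comment> \<open>A diagonal entry of the Gram matrix is the sum of squares of a column.\<close>
  have "(\<Sum>k = 0..<m. A $$ (k, j) * A $$ (k, j)) = (transpose_mat A * A) $$ (j, j)"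
    using A j by (auto simp: scalar_prod_def)
  also have "\<dots> = 0" using 0 j by simp
  finally have "\<forall>k\<in>{0..<m}. A $$ (k, j) * A $$ (k, j) = 0"
    by (subst (asm) sum_nonneg_eq_0_iff) auto
  then show "A $$ (i, j) = 0\<^sub>m m n $$ (i, j)" using i j by auto
qed (use A in auto)

text \<open>For E = A (C - D) the hypothesis says A^T E = 0, whence E^T E = (C - D)^T A^T E = 0 and
  E vanishes.\<close>

lemma transpose_mult_cancel:
  fixes A :: "real mat"
  assumes A: "A \<in> carrier_mat m n" and C: "C \<in> carrier_mat n k" and D: "D \<in> carrier_mat n k"
    and eq: "transpose_mat A * (A * C) = transpose_mat A * (A * D)"
  shows "A * C = A * D"
proof -
  let ?E = "A * (C - D)"
  have CD: "C - D \<in> carrier_mat n k" using D by auto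
  have E: "?E \<in> carrier_mat m k" using A CD by auto
  have "transpose_mat A * ?E = 0\<^sub>m n k"
    using A C D eq by (simp add: mult_minus_distrib_mat[of _ m n _ k] mult_minus_distrib_mat[of _ n m _ k] minus_mat_eq_zero_iff[of _ n k])
  then have "transpose_mat ?E * ?E = 0\<^sub>m k k"
    using A C D CD by (simp add: transpose_mult[of _ m n _ k] mult_mat_assoc_dim)
  then have "?E = 0\<^sub>m m k" by (rule transpose_mult_self_eq_zero[OF E])
  then show ?thesis
    using A C D by (simp add: mult_minus_distrib_mat[of _ m n _ k] minus_mat_eq_zero_iff[of _ m k])
qed

text \<open>Any 1-inverse of the Gram matrix of \<open>A\<close> gives the orthogonal projection onto its range.\<close>

lemma range_projection_exists:
  fixes A :: "real mat"
  assumes A: "A \<in> carrier_mat m n"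
  obtains G where "G \<in> carrier_mat n n"
    "A * G * transpose_mat A * A = A"
    "transpose_mat (A * G * transpose_mat A) = A * G * transpose_mat A"
proof -
  let ?T = "transpose_mat A"
  have T: "?T \<in> carrier_mat n m" using A by simp
  have "?T * A \<in> carrier_mat n n" using A by simp
  from ginverse_exists[OF this] obtain G
    where G: "G \<in> carrier_mat n n" and G1: "?T * A * G * (?T * A) = ?T * A" by blast
  \<comment> \<open>\<open>G1\<close> is regrouped with A^T in front, so that cancelling it leaves A
    G A^T A = A.\<close>
  have "?T * (A * (G * (?T * A))) = ?T * (A * 1\<^sub>m n)"
    using A T G G1 by (simp add: mult_mat_assoc_dim)
  then have "A * (G * (?T * A)) = A * 1\<^sub>m n"
    by (intro transpose_mult_cancel[OF A, of _ n]) (use A T G in auto)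
  then have PA: "A * G * ?T * A = A"
    using A T G by (simp add: mult_mat_assoc_dim)
  define P where "P = A * G * ?T"
  have P: "P \<in> carrier_mat m m" using A T G by (simp add: P_def)
  have P_T: "transpose_mat P = A * transpose_mat G * ?T"
    using A T G by (simp add: P_def transpose_mult[of _ m n] transpose_mult[of _ m n _ m] transpose_mult[of _ n n] mult_mat_assoc_dim)
  \<comment> \<open>\<open>G\<close> may fail to be symmetric; symmetry of \<open>P\<close> comes
    from P P^T = P^T, whose left side is symmetric.\<close>
  have "P * transpose_mat P = P * A * (transpose_mat G * ?T)"
    unfolding P_T using P A T G by (simp add: mult_mat_assoc_dim)
  also have "\<dots> = transpose_mat P"
    using PA A T G by (simp add: P_T P_def[symmetric] mult_mat_assoc_dim)
  finally have "P * transpose_mat P = transpose_mat P" .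
  then have "transpose_mat P = P"
    using transpose_mult[OF P, of "transpose_mat P" m] P by simp
  then show thesis using that G PA by (simp add: P_def)
qed

text \<open>With the projections P = A G A^T and Q = A^T H A, the matrix X = A^T H A G A^T reads
  both as A^T H P and as Q G A^T. The first reading gives X A = Q, the second A X = P.\<close>

lemma mp_inverse_exists:
  assumes A: "A \<in> carrier_mat m n"
  shows "\<exists>X. is_mp_inverse A X"
proof -
  let ?T = "transpose_mat A"
  have T: "?T \<in> carrier_mat n m" using A by simp
  obtain G where G: "G \<in> carrier_mat n n" and PA: "A * G * ?T * A = A"
    and P_T: "transpose_mat (A * G * ?T) = A * G * ?T"
    by (rule range_projection_exists[OF A])
  obtain H where H: "H \<in> carrier_mat m m" and QT: "?T * H * A * ?T = ?T"
    and Q_T: "transpose_mat (?T * H * A) = ?T * H * A"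
    using range_projection_exists[OF T] by auto
  define P where "P = A * G * ?T"
  define Q where "Q = ?T * H * A"
  have P: "P \<in> carrier_mat m m" and Q: "Q \<in> carrier_mat n n"
    using A T G H by (simp_all add: P_def Q_def)
  have AQ: "A * Q = A"
    using QT Q_T A Q transpose_mult[OF Q T] unfolding Q_def[symmetric] by simp
  define X where "X = ?T * H * P"
  have X: "X \<in> carrier_mat n m" using T H P by (simp add: X_def)
  have X': "X = Q * G * ?T" using A T G H by (simp add: X_def P_def Q_def mult_mat_assoc_dim)
  have "A * X = (A * Q) * G * ?T" using A T G Q by (simp add: X' mult_mat_assoc_dim)
  then have AX: "A * X = P" by (simp add: AQ P_def)
  have "X * A = ?T * H * (P * A)" using A T H P by (simp add: X_def mult_mat_assoc_dim)
  then have XA: "X * A = Q" using PA by (simp add: P_def Q_def)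
  have "X * A * X = (Q * ?T) * (H * P)" unfolding XA using Q T H P by (simp add: X_def mult_mat_assoc_dim)
  also have "\<dots> = X" using QT T H P by (simp add: X_def Q_def[symmetric] mult_mat_assoc_dim)
  finally have "X * A * X = X" .
  moreover have "A * X * A = A" using PA by (simp add: AX P_def)
  ultimately have "is_mp_inverse A X"
    using A X P_T Q_T unfolding is_mp_inverse_def AX XA by (simp add: P_def Q_def)
  then show ?thesis ..
qed

lemma mp_inverse:
  assumes A: "A \<in> carrier_mat m n"
  shows "mp_inverse A \<in> carrier_mat n m"
    and "A * mp_inverse A * A = A"
    and "mp_inverse A * A * mp_inverse A = mp_inverse A"
    and "transpose_mat (A * mp_inverse A) = A * mp_inverse A"
    and "transpose_mat (mp_inverse A * A) = mp_inverse A * A"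
proof -
  have "is_mp_inverse A (mp_inverse A)"
    unfolding mp_inverse_def using mp_inverse_exists[OF A] by (rule someI_ex)
  then show "mp_inverse A \<in> carrier_mat n m"
    and "A * mp_inverse A * A = A"
    and "mp_inverse A * A * mp_inverse A = mp_inverse A"
    and "transpose_mat (A * mp_inverse A) = A * mp_inverse A"
    and "transpose_mat (mp_inverse A * A) = mp_inverse A * A"
    using A by (auto simp: is_mp_inverse_def)
qed

subsection \<open>Proper splittings\<close>

text \<open>A A^+ fixes every vector A x, and each column U e_j of \<open>U\<close> has that
  form.\<close>

lemma range_projection_mult:
  assumes A: "A \<in> carrier_mat m n" and U: "U \<in> carrier_mat m n"
    and range: "range_mat U \<subseteq> range_mat A"
  shows "A * mp_inverse A * U = U"
proof (rule mat_col_eqI)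
  note mp = mp_inverse[OF A]
  fix j assume "j < dim_col U"
  then have j: "j < n" using U by simp
  have "col U j = U *\<^sub>v unit_vec n j" using U j by (intro eq_vecI) auto
  then have "col U j \<in> range_mat U" using U j by (auto simp: range_mat_def)
  then obtain x where x: "x \<in> carrier_vec n" "col U j = A *\<^sub>v x"
    using range A by (auto simp: range_mat_def)
  have "col (A * mp_inverse A * U) j = (A * mp_inverse A) *\<^sub>v col U j"
    using A U mp(1) j by (intro col_mult2[of _ m m]) auto
  also have "\<dots> = (A * mp_inverse A * A) *\<^sub>v x"
    using A mp(1) x by (simp flip: assoc_mult_mat_vec[of _ m m _ n])
  finally show "col (A * mp_inverse A * U) j = col U j" using mp(2) x by simp
qed (use A U mp_inverse(1)[OF A] in auto)

text \<open>The columns of 1 - U^+ U lie in the null space of \<open>U\<close>, so \<open>A\<close>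
  kills them.\<close>

lemma null_projection_mult:
  assumes A: "A \<in> carrier_mat m n" and U: "U \<in> carrier_mat m n"
    and null: "null_mat U \<subseteq> null_mat A"
  shows "A * (mp_inverse U * U) = A"
proof -
  note mp = mp_inverse[OF U]
  let ?D = "1\<^sub>m n - mp_inverse U * U"
  have D: "?D \<in> carrier_mat n n" using U mp(1) by auto
  have "U * (mp_inverse U * U) = U"
    using U mp(1,2) by (simp add: mult_mat_assoc_dim)
  then have UD: "U * ?D = 0\<^sub>m m n"
    using U mp(1) by (simp add: mult_minus_distrib_mat[of _ m n _ n])
  have "A * ?D = 0\<^sub>m m n"
  proof (rule mat_col_eqI)
    fix j assume "j < dim_col (0\<^sub>m m n :: real mat)"
    then have j: "j < n" by simp
    have "U *\<^sub>v col ?D j = col (U * ?D) j" using col_mult2[OF U D j] by simp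
    then have "U *\<^sub>v col ?D j = 0\<^sub>v m" using j by (simp add: UD)
    moreover have "col ?D j \<in> carrier_vec n" using U mp(1) by (intro carrier_vecI) simp
    ultimately have "col ?D j \<in> null_mat U" using U by (simp add: null_mat_def)
    then have "A *\<^sub>v col ?D j = 0\<^sub>v m" using null A by (auto simp: null_mat_def)
    then show "col (A * ?D) j = col (0\<^sub>m m n) j" using col_mult2[OF A D j] j by simp
  qed (use A D in auto)
  then show ?thesis
    using A U mp(1) by (simp add: mult_minus_distrib_mat[of _ m n _ n] minus_mat_eq_zero_iff[of _ m n])
qed

text \<open>Transposing P Q = Q gives Q P = Q by symmetry, while Q P = P by assumption.\<close>

lemma symmetric_mutual_absorb:
  fixes P Q :: "real mat"
  assumes P: "P \<in> carrier_mat n n" and Q: "Q \<in> carrier_mat n n"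
    and sym: "transpose_mat P = P" "transpose_mat Q = Q"
    and PQ: "P * Q = Q" and QP: "Q * P = P"
  shows "P = Q"
  using transpose_mult[OF P Q] by (simp add: sym PQ QP)

text \<open>A A^+ is the orthogonal projection onto the range of \<open>A\<close>, and A^+ A the one
  along its null space; a proper splitting preserves both spaces.\<close>

lemma proper_splitting_projections:
  assumes A: "A \<in> carrier_mat m n" and U: "U \<in> carrier_mat m n"
    and split: "proper_splitting A U V"
  shows "A * mp_inverse A = U * mp_inverse U"
    and "mp_inverse A * A = mp_inverse U * U"
proof -
  note a = mp_inverse[OF A] and u = mp_inverse[OF U]
  have range: "range_mat U = range_mat A" and null: "null_mat U = null_mat A"
    using split by (auto simp: proper_splitting_def)
  show "A * mp_inverse A = U * mp_inverse U"
  proof (rule symmetric_mutual_absorb[of _ m])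
    show "A * mp_inverse A * (U * mp_inverse U) = U * mp_inverse U"
      using A U a(1) u(1) range_projection_mult[OF A U] range
        mult_mat_assoc_dim[of "A * mp_inverse A" U "mp_inverse U"] by simp
    show "U * mp_inverse U * (A * mp_inverse A) = A * mp_inverse A"
      using A U a(1) u(1) range_projection_mult[OF U A] range
        mult_mat_assoc_dim[of "U * mp_inverse U" A "mp_inverse A"] by simp
  qed (use A U a u in auto)
  show "mp_inverse A * A = mp_inverse U * U"
  proof (rule symmetric_mutual_absorb[of _ n, symmetric])
    \<comment> \<open>Equal null spaces yield absorption on the right; transposing the symmetric
      factors puts it in the order that \<open>symmetric_mutual_absorb\<close> expects.\<close>
    have "mp_inverse A * A * (mp_inverse U * U) = mp_inverse A * A"
      using A U a(1) u(1) null_projection_mult[OF A U] null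
      by (simp add: mult_mat_assoc_dim)
    then show "mp_inverse U * U * (mp_inverse A * A) = mp_inverse A * A"
      using A U a u transpose_mult[of "mp_inverse A * A" n n "mp_inverse U * U" n] by simp
    have "mp_inverse U * U * (mp_inverse A * A) = mp_inverse U * U"
      using A U a(1) u(1) null_projection_mult[OF U A] null
      by (simp add: mult_mat_assoc_dim)
    then show "mp_inverse A * A * (mp_inverse U * U) = mp_inverse U * U"
      using A U a u transpose_mult[of "mp_inverse U * U" n n "mp_inverse A * A" n] by simp
  qed (use A U a u in auto)
qed

text \<open>Substituting V = U - A gives U^+ V A^+ = U^+ U A^+ - U^+ A A^+, and exchanging the
  common projections turns the terms into A^+ and U^+. The mirrored product gives the second
  identity. Type I splittings use the first, type II the second.\<close>

lemma proper_splitting_resolvent: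
  assumes A: "A \<in> carrier_mat m n" and U: "U \<in> carrier_mat m n" and V: "V \<in> carrier_mat m n"
    and split: "proper_splitting A U V"
  shows "mp_inverse U = mp_inverse A - mp_inverse U * V * mp_inverse A" (is ?I)
    and "mp_inverse U = mp_inverse A - mp_inverse A * V * mp_inverse U" (is ?II)
proof -
  note a = mp_inverse[OF A] and u = mp_inverse[OF U]
  note pr = proper_splitting_projections[OF A U split]
  have "A = U - V" using split by (simp add: proper_splitting_def)
  then have V': "V = U - A" using U V by (intro eq_matI) auto
  have "mp_inverse U * V * mp_inverse A = mp_inverse U * U * mp_inverse A - mp_inverse U * A * mp_inverse A"
    unfolding V' using A U a(1) u(1)
    by (simp add: mult_minus_distrib_mat[of _ n m] minus_mult_distrib_mat[of _ n n])
  also have "mp_inverse U * A * mp_inverse A = mp_inverse U * U * mp_inverse U"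
    using A U a(1) u(1) pr by (simp add: mult_mat_assoc_dim)
  \<comment> \<open>The two calls of \<open>simp\<close> exchange projections in opposite
    directions: those of \<open>A\<close> collapse one term, those of \<open>U\<close> the
    other.\<close>
  finally have "mp_inverse U * V * mp_inverse A = mp_inverse A - mp_inverse U"
    by (simp add: pr[symmetric] a(3)) (simp add: pr u(3))
  then show ?I using a(1) u(1) by (intro eq_matI) auto
  have "mp_inverse A * V * mp_inverse U = mp_inverse A * U * mp_inverse U - mp_inverse A * A * mp_inverse U"
    unfolding V' using A U a(1) u(1)
    by (simp add: mult_minus_distrib_mat[of _ n m] minus_mult_distrib_mat[of _ n n])
  also have "mp_inverse A * U * mp_inverse U = mp_inverse A * (A * mp_inverse A)"
    unfolding pr(1) using U a(1) u(1) by (simp add: mult_mat_assoc_dim)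
  also have "\<dots> = mp_inverse A * A * mp_inverse A"
    using A a(1) by (simp add: mult_mat_assoc_dim)
  finally have "mp_inverse A * V * mp_inverse U = mp_inverse A - mp_inverse U"
    by (simp add: a(3)) (simp add: pr u(3))
  then show ?II using a(1) u(1) by (intro eq_matI) auto
qed

subsection \<open>Perron vectors of nonnegative matrices\<close>

lemma convergent_subseq_finite:
  fixes f :: "nat \<Rightarrow> nat \<Rightarrow> real"
  assumes "\<And>i. i < n \<Longrightarrow> Bseq (\<lambda>k. f k i)"
  shows "\<exists>l r. strict_mono (r :: nat \<Rightarrow> nat) \<and> (\<forall>i<n. (\<lambda>k. f (r k) i) \<longlonglongrightarrow> l i)"
  using assms
proof (induction n)
  case 0
  then show ?case by (auto intro: strict_mono_id)
next
  case (Suc n)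
  then obtain l r where r: "strict_mono r" and l: "\<And>i. i < n \<Longrightarrow> (\<lambda>k. f (r k) i) \<longlonglongrightarrow> l i"
    by (metis less_Suc_eq)
  \<comment> \<open>A subsequence with monotone last coordinate converges there by boundedness; the
    coordinates already handled keep their limits.\<close>
  obtain s where s: "strict_mono s" "monoseq (\<lambda>k. f (r (s k)) n)"
    using seq_monosub[of "\<lambda>k. f (r k) n"] by (auto simp: o_def)
  have "Bseq (\<lambda>k. f (r (s k)) n)"
    using Bseq_subseq[OF Suc.prems[of n], of "r \<circ> s"] by (simp add: o_def)
  with s(2) obtain z where z: "(\<lambda>k. f (r (s k)) n) \<longlonglongrightarrow> z"
    using Bseq_monoseq_convergent convergent_def by blast
  have "(\<lambda>k. f ((r \<circ> s) k) i) \<longlonglongrightarrow> (l(n := z)) i" if "i < Suc n" for i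
  proof (cases "i = n")
    case False
    then have "(\<lambda>k. f (r k) i) \<longlonglongrightarrow> l i" using that l by simp
    from LIMSEQ_subseq_LIMSEQ[OF this s(1)] False show ?thesis by (simp add: o_def)
  qed (use z in simp)
  moreover have "strict_mono (r \<circ> s)" using r s(1) by (rule strict_mono_o)
  ultimately show ?case by blast
qed

text \<open>Writing x as the square of its root leaves one geometric factor for the extra power of n
  and one for the induction hypothesis.\<close>

lemma poly_times_geometric_tendsto_zero:
  fixes x :: real
  assumes "0 \<le> x" "x < 1"
  shows "(\<lambda>n. real n ^ d * x ^ n) \<longlonglongrightarrow> 0"
  using assms
proof (induction d arbitrary: x)
  case 0
  then show ?case by (simp add: LIMSEQ_power_zero)
next
  case (Suc d)
  define z where "z = sqrt x"
  have z: "0 \<le> z" "z < 1" "x = z * z" using Suc.prems by (auto simp: z_def)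
  have "(\<lambda>n. (real n * z ^ n) * (real n ^ d * z ^ n)) \<longlonglongrightarrow> 0 * 0"
    using powser_times_n_limit_0[of z] Suc.IH[of z] z by (intro tendsto_mult) auto
  then show ?case by (simp add: z(3) power_mult_distrib mult_ac)
qed

text \<open>Otherwise the partial sums of \<open>a\<close> would grow exponentially.\<close>

lemma small_increment_exists:
  fixes a :: "nat \<Rightarrow> real"
  assumes pos: "\<And>k. a k > 0" and bound: "\<And>k. a k \<le> c1 + c2 * real k ^ d" and \<epsilon>: "\<epsilon> > 0"
  shows "\<exists>K>0. a K \<le> \<epsilon> * (\<Sum>k<K. a k)"
proof (rule ccontr)
  assume "\<not> ?thesis"
  then have neg: "a K > \<epsilon> * (\<Sum>k<K. a k)" if "K > 0" for K using that by (meson not_le)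
  \<comment> \<open>By \<open>neg\<close>, each partial sum is at least 1 + \<epsilon> times the
    previous one.\<close>
  have grow: "(\<Sum>k<Suc K. a k) \<ge> (1 + \<epsilon>) ^ K * a 0" for K
  proof (induction K)
    case (Suc K)
    have "(1 + \<epsilon>) ^ Suc K * a 0 = (1 + \<epsilon>) * ((1 + \<epsilon>) ^ K * a 0)" by simp
    also have "\<dots> \<le> (1 + \<epsilon>) * (\<Sum>k<Suc K. a k)" using Suc \<epsilon> by (intro mult_left_mono) auto
    also have "\<dots> \<le> (\<Sum>k<Suc K. a k) + a (Suc K)"
      using neg[of "Suc K"] by (simp add: distrib_right)
    finally show ?case by simp
  qed simp
  \<comment> \<open>Multiplying by x^(K+1) makes the exponential lower bound a positive constant,
    while the polynomial upper bound tends to 0.\<close>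
  define x where "x = 1 / (1 + \<epsilon>)"
  have x: "0 < x" "x < 1" "(1 + \<epsilon>) * x = 1" using \<epsilon> by (auto simp: x_def)
  have "\<epsilon> * a 0 * x \<le> c1 * x ^ Suc K + c2 * (real (Suc K) ^ d * x ^ Suc K)" for K
  proof -
    have "(1 + \<epsilon>) ^ K * (\<epsilon> * a 0) \<le> \<epsilon> * (\<Sum>k<Suc K. a k)"
      using mult_left_mono[OF grow[of K], of \<epsilon>] \<epsilon> by (simp add: mult_ac)
    also have "\<dots> \<le> c1 + c2 * real (Suc K) ^ d"
      using neg[of "Suc K"] bound[of "Suc K"] by (simp del: sum.lessThan_Suc)
    finally have "(1 + \<epsilon>) ^ K * (\<epsilon> * a 0) * x ^ Suc K \<le> (c1 + c2 * real (Suc K) ^ d) * x ^ Suc K"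
      using x by (intro mult_right_mono) auto
    also have "(1 + \<epsilon>) ^ K * (\<epsilon> * a 0) * x ^ Suc K = ((1 + \<epsilon>) * x) ^ K * (\<epsilon> * a 0) * x"
      unfolding power_mult_distrib by simp
    also have "\<dots> = \<epsilon> * a 0 * x" unfolding x(3) by simp
    finally show ?thesis by (simp only: distrib_right mult.assoc)
  qed
  moreover have "(\<lambda>K. c1 * x ^ Suc K + c2 * (real (Suc K) ^ d * x ^ Suc K)) \<longlonglongrightarrow> c1 * 0 + c2 * 0"
    using LIMSEQ_Suc[OF LIMSEQ_power_zero[of x]] LIMSEQ_Suc[OF poly_times_geometric_tendsto_zero[of x d]] x
    by (intro tendsto_add tendsto_mult_left) auto
  ultimately have "\<epsilon> * a 0 * x \<le> c1 * 0 + c2 * 0"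
    by (intro LIMSEQ_le_const) auto
  then have "\<epsilon> * a 0 * x \<le> 0" by simp
  moreover have "\<epsilon> * a 0 * x > 0" using \<epsilon> pos x by simp
  ultimately show False by simp
qed

section \<open>Spectral radius under scaling, transposition and commutation\<close>

lemma eigenvalue_le_spectral_radius:
  assumes A: "A \<in> carrier_mat n n" and n: "n > 0" and ev: "eigenvalue A a"
  shows "norm a \<le> spectral_radius A"
  using spectral_radius_mem_max(2)[OF A n, of "norm a"] ev by (auto simp: spectrum_def)

lemma spectral_radius_eigenvector:
  assumes A: "A \<in> carrier_mat n n" and n: "n > 0"
  obtains a v where "eigenvector A v a" "norm a = spectral_radius A"
  using spectral_radius_mem_max(1)[OF A n] by (auto simp: spectrum_def eigenvalue_def)

text \<open>Eigenvectors of c A are eigenvectors of A with the eigenvalue divided by c. This serves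
  to normalise the radius to at most 1.\<close>

lemma spectral_radius_smult_le:
  assumes A: "A \<in> carrier_mat n n" and n: "n > 0" and c: "c \<noteq> 0"
  shows "spectral_radius (c \<cdot>\<^sub>m A) \<le> norm c * spectral_radius A"
proof -
  have cA: "c \<cdot>\<^sub>m A \<in> carrier_mat n n" using A by simp
  obtain a v where ev: "eigenvector (c \<cdot>\<^sub>m A) v a" and a: "norm a = spectral_radius (c \<cdot>\<^sub>m A)"
    using spectral_radius_eigenvector[OF cA n] .
  have v: "v \<in> carrier_vec n" "v \<noteq> 0\<^sub>v n" and eq: "(c \<cdot>\<^sub>m A) *\<^sub>v v = a \<cdot>\<^sub>v v"
    using ev A by (auto simp: eigenvector_def)
  have "A *\<^sub>v v = (a / c) \<cdot>\<^sub>v v"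
  proof (rule eq_vecI)
    fix i assume "i < dim_vec ((a / c) \<cdot>\<^sub>v v)"
    then have i: "i < n" using v by simp
    have "c * (A *\<^sub>v v) $ i = ((c \<cdot>\<^sub>m A) *\<^sub>v v) $ i"
      using A v i by simp
    then show "(A *\<^sub>v v) $ i = ((a / c) \<cdot>\<^sub>v v) $ i"
      using c i v by (simp add: eq field_simps)
  qed (use A v in auto)
  then have "eigenvalue A (a / c)"
    using A v unfolding eigenvalue_def eigenvector_def by auto
  then have "norm (a / c) \<le> spectral_radius A"
    by (rule eigenvalue_le_spectral_radius[OF A n])
  then show ?thesis using a c by (simp add: norm_divide field_simps)
qed

lemma spec_rad_eigenvector:
  assumes A: "A \<in> carrier_mat n n" and n: "n > 0"
  obtains a v where "v \<in> carrier_vec n" "v \<noteq> 0\<^sub>v n"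
    "map_mat complex_of_real A *\<^sub>v v = a \<cdot>\<^sub>v v" "norm a = spec_rad A"
proof -
  have "map_mat complex_of_real A \<in> carrier_mat n n" using A by simp
  from spectral_radius_eigenvector[OF this n] show thesis
    using that A by (auto simp: spec_rad_def eigenvector_def)
qed

text \<open>A matrix and its transpose share the characteristic polynomial, hence the
  spectrum.\<close>

lemma spec_rad_transpose:
  assumes A: "A \<in> carrier_mat n n"
  shows "spec_rad (transpose_mat A) = spec_rad A"
proof -
  let ?C = "map_mat complex_of_real A"
  have C: "?C \<in> carrier_mat n n" using A by simp
  have "map_mat complex_of_real (transpose_mat A) = transpose_mat ?C"
    by (rule eq_matI) auto
  moreover have "spectrum (transpose_mat ?C) = spectrum ?C"
    using C by (simp add: spectrum_root_char_poly[of _ n])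
  ultimately show ?thesis by (simp add: spec_rad_def spectral_radius_def)
qed

text \<open>If A B v = a v, then B v is an eigenvector of B A for the same a. Positivity makes a
  nonzero, which keeps B v from vanishing.\<close>

lemma spec_rad_mult_commute_le:
  assumes A: "A \<in> carrier_mat m n" and B: "B \<in> carrier_mat n m" and m: "m > 0" and n: "n > 0"
    and pos: "spec_rad (A * B) > 0"
  shows "spec_rad (A * B) \<le> spec_rad (B * A)"
proof -
  let ?A = "map_mat complex_of_real A" and ?B = "map_mat complex_of_real B"
  have cA: "?A \<in> carrier_mat m n" and cB: "?B \<in> carrier_mat n m" using A B by auto
  have AB: "A * B \<in> carrier_mat m m" and BA: "B * A \<in> carrier_mat n n" using A B by auto
  obtain v a where v: "v \<in> carrier_vec m" "v \<noteq> 0\<^sub>v m"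
    and ev: "map_mat complex_of_real (A * B) *\<^sub>v v = a \<cdot>\<^sub>v v" and a: "norm a = spec_rad (A * B)"
    using spec_rad_eigenvector[OF AB m] .
  let ?w = "?B *\<^sub>v v"
  have w: "?w \<in> carrier_vec n" using cB v by simp
  have hom: "map_mat complex_of_real (A * B) = ?A * ?B" "map_mat complex_of_real (B * A) = ?B * ?A"
    using A B by (simp_all add: of_real_hom.mat_hom_mult)
  have Aw: "?A *\<^sub>v ?w = a \<cdot>\<^sub>v v"
    using ev cA cB v by (simp add: hom assoc_mult_mat_vec[of _ m n _ m])
  have "a \<noteq> 0" using a pos by auto
  have "?w \<noteq> 0\<^sub>v n"
  proof
    assume "?w = 0\<^sub>v n"
    moreover have "?A *\<^sub>v 0\<^sub>v n = 0\<^sub>v m" using cA by (intro eq_vecI) auto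
    ultimately have "a \<cdot>\<^sub>v v = 0\<^sub>v m" using Aw by simp
    then have "v = 0\<^sub>v m"
      using v \<open>a \<noteq> 0\<close> by (auto simp: vec_eq_iff)
    then show False using v by simp
  qed
  moreover have "map_mat complex_of_real (B * A) *\<^sub>v ?w = a \<cdot>\<^sub>v ?w"
    using cA cB v w Aw by (simp add: hom assoc_mult_mat_vec[of _ n m _ n] mult_mat_vec)
  ultimately have "eigenvalue (map_mat complex_of_real (B * A)) a"
    using w B unfolding eigenvalue_def eigenvector_def by auto
  then show ?thesis
    using eigenvalue_le_spectral_radius[of "map_mat complex_of_real (B * A)" n a] BA n a
    by (simp add: spec_rad_def)
qed

text \<open>The first inequality also supplies the positivity that the reverse one requires.\<close>

lemma spec_rad_mult_commute:
  assumes A: "A \<in> carrier_mat m n" and B: "B \<in> carrier_mat n m" and m: "m > 0" and n: "n > 0"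
    and pos: "spec_rad (A * B) > 0"
  shows "spec_rad (B * A) = spec_rad (A * B)"
  using spec_rad_mult_commute_le[OF A B m n pos] spec_rad_mult_commute_le[OF B A n m] pos by simp

section \<open>Powers of nonnegative matrices and Perron vectors\<close>

lemma power_entries_poly_bound:
  assumes A: "A \<in> carrier_mat n n" and le: "spec_rad A \<le> 1"
  obtains c1 c2 where
    "\<And>k i j. i < n \<Longrightarrow> j < n \<Longrightarrow> \<bar>(A ^\<^sub>m k) $$ (i, j)\<bar> \<le> c1 + c2 * real k ^ (n - 1)"
proof -
  have "map_mat complex_of_real A \<in> carrier_mat n n" using A by simp
  \<comment> \<open>Jordan blocks have size at most n, so with eigenvalues of modulus at most 1 the
    powers grow at most like k^(n-1).\<close>
  from spectral_radius_jnf_norm_bound_le_1_upper_triangular[OF this le[unfolded spec_rad_def]]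
  obtain c1 c2 where c: "\<And>k. norm_bound (map_mat complex_of_real A ^\<^sub>m k) (c1 + c2 * real k ^ (n - 1))"
    by auto
  have "\<bar>(A ^\<^sub>m k) $$ (i, j)\<bar> \<le> c1 + c2 * real k ^ (n - 1)" if "i < n" "j < n" for k i j
  proof -
    have "map_mat complex_of_real A ^\<^sub>m k = map_mat complex_of_real (A ^\<^sub>m k)"
      using A by (simp add: of_real_hom.mat_hom_pow)
    moreover have "A ^\<^sub>m k \<in> carrier_mat n n" using A by simp
    ultimately show ?thesis using c[of k] that unfolding norm_bound_def by (auto simp del: pow_mat_dim)
  qed
  then show thesis using that by blast
qed

lemma mult_pow_mat_commute:
  fixes A :: "'a :: semiring_1 mat"
  assumes A: "A \<in> carrier_mat n n"
  shows "A * A ^\<^sub>m k = A ^\<^sub>m Suc k"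
proof (induction k)
  case (Suc k)
  have "A * A ^\<^sub>m Suc k = A * A ^\<^sub>m k * A"
    using A by (simp add: assoc_mult_mat[of _ n n _ n _ n])
  then show ?case using Suc by simp
qed (use A in simp)

text \<open>Multiplication by a nonnegative matrix preserves the entrywise order, so u \<le> C u
  propagates along the iterates.\<close>

lemma nonneg_sub_eigenvector_iterates:
  assumes C: "C \<in> carrier_mat n n" and nn: "nonneg_mat C"
    and u: "u \<in> carrier_vec n" and sub: "\<And>i. i < n \<Longrightarrow> u $ i \<le> (C *\<^sub>v u) $ i"
    and i: "i < n"
  shows "u $ i \<le> (C ^\<^sub>m k *\<^sub>v u) $ i"
  using i
proof (induction k arbitrary: i)
  case 0
  then show ?case using C u by simp
next
  case (Suc k)
  have Ck: "C ^\<^sub>m k \<in> carrier_mat n n" using C by simp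
  have "u $ i \<le> (C *\<^sub>v u) $ i" using Suc.prems by (rule sub)
  also have "\<dots> = (\<Sum>j = 0..<n. C $$ (i, j) * u $ j)"
    using Suc.prems C u by (simp add: scalar_prod_def)
  also have "\<dots> \<le> (\<Sum>j = 0..<n. C $$ (i, j) * (C ^\<^sub>m k *\<^sub>v u) $ j)"
    using Suc nn C by (intro sum_mono mult_left_mono) (auto simp: nonneg_mat_def)
  also have "\<dots> = (C *\<^sub>v (C ^\<^sub>m k *\<^sub>v u)) $ i"
    using Suc.prems C Ck u by (simp add: scalar_prod_def)
  also have "C *\<^sub>v (C ^\<^sub>m k *\<^sub>v u) = C ^\<^sub>m Suc k *\<^sub>v u"
    using assoc_mult_mat_vec[OF C Ck u] mult_pow_mat_commute[OF C] by simp
  finally show ?case .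
qed


text \<open>The fixed vector is a limit of normalized Cesaro sums of the iterates of \<open>u\<close>. These sums are
  almost invariant along indices where the next iterate is small relative to the sum.\<close>

lemma fixed_vector_of_subinvariant:
  assumes C: "C \<in> carrier_mat n n" and nn: "nonneg_mat C" and le: "spec_rad C \<le> 1"
    and u: "u \<in> carrier_vec n" "u \<noteq> 0\<^sub>v n" and u_nn: "\<And>i. i < n \<Longrightarrow> 0 \<le> u $ i"
    and sub: "\<And>i. i < n \<Longrightarrow> u $ i \<le> (C *\<^sub>v u) $ i"
  obtains y where "y \<in> carrier_vec n" "y \<noteq> 0\<^sub>v n" "\<And>i. i < n \<Longrightarrow> 0 \<le> y $ i" "C *\<^sub>v y = y"
proof -
  define p where "p k i = (C ^\<^sub>m k *\<^sub>v u) $ i" for k i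
  define a where "a k = (\<Sum>i = 0..<n. p k i)" for k
  have Ck: "C ^\<^sub>m k \<in> carrier_mat n n" for k using C by simp
  have p_0: "p 0 i = u $ i" if "i < n" for i
    using that C u by (simp add: p_def)
  have p_Suc: "p (Suc k) i = (\<Sum>j = 0..<n. C $$ (i, j) * p k j)" if "i < n" for k i
  proof -
    have "C ^\<^sub>m Suc k *\<^sub>v u = C *\<^sub>v (C ^\<^sub>m k *\<^sub>v u)"
      using assoc_mult_mat_vec[OF C Ck u(1)] mult_pow_mat_commute[OF C] by simp
    then show ?thesis
      unfolding p_def using that C Ck[of k] u(1) by (simp add: scalar_prod_def del: pow_mat.simps)
  qed
  have p_ge: "u $ i \<le> p k i" if "i < n" for k i
    unfolding p_def by (rule nonneg_sub_eigenvector_iterates[OF C nn u(1) sub that])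
  have p_nn: "0 \<le> p k i" if "i < n" for k i
    using p_ge[OF that, of k] u_nn[OF that] by linarith
  have p_le: "p k i \<le> a k" if "i < n" for k i
    unfolding a_def using that p_nn by (intro member_le_sum) auto
  \<comment> \<open>The iterates dominate \<open>u\<close>, so a nonzero entry of \<open>u\<close>
    keeps every \<open>a k\<close> positive.\<close>
  obtain i0 where i0: "i0 < n" "u $ i0 \<noteq> 0" using u by (auto simp: vec_eq_iff)
  have a_pos: "a k > 0" for k
    using p_le[OF i0(1), of k] p_ge[OF i0(1), of k] u_nn[OF i0(1)] i0(2) by linarith
  obtain c1 c2 where c: "\<And>k i j. i < n \<Longrightarrow> j < n \<Longrightarrow> \<bar>(C ^\<^sub>m k) $$ (i, j)\<bar> \<le> c1 + c2 * real k ^ (n - 1)"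
    using power_entries_poly_bound[OF C le] by blast
  define s where "s = (\<Sum>j = 0..<n. u $ j)"
  have "p k i \<le> (c1 + c2 * real k ^ (n - 1)) * s" if "i < n" for k i
  proof -
    have "p k i = (\<Sum>j = 0..<n. (C ^\<^sub>m k) $$ (i, j) * u $ j)"
      unfolding p_def using that Ck[of k] u(1) by (simp add: scalar_prod_def del: pow_mat_dim)
    also have "\<dots> \<le> (\<Sum>j = 0..<n. (c1 + c2 * real k ^ (n - 1)) * u $ j)"
      using c[OF that, of _ k] u_nn by (intro sum_mono mult_right_mono) (auto simp: abs_le_iff)
    finally show ?thesis by (simp add: s_def sum_distrib_left)
  qed
  then have "a k \<le> (\<Sum>i = 0..<n. (c1 + c2 * real k ^ (n - 1)) * s)" for k
    unfolding a_def by (intro sum_mono) auto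
  then have a_le: "a k \<le> real n * s * c1 + (real n * s * c2) * real k ^ (n - 1)" for k
    by (simp add: algebra_simps)
  have "\<exists>K>0. a K \<le> inverse (real (Suc m)) * (\<Sum>k<K. a k)" for m
    by (rule small_increment_exists[OF a_pos a_le]) simp
  then obtain K where K: "\<And>m. K m > 0" "\<And>m. a (K m) \<le> inverse (real (Suc m)) * (\<Sum>k<K m. a k)"
    by metis
  define S where "S m = (\<Sum>k<K m. a k)" for m
  have S_pos: "S m > 0" for m
    unfolding S_def using K(1)[of m] a_pos by (intro sum_pos) auto
  \<comment> \<open>Division by \<open>S m\<close> puts these vectors in the standard simplex: they
    are bounded, and entry sum 1 keeps their limit nonzero.\<close>
  define y where "y m i = (\<Sum>k<K m. p k i) / S m" for m i
  have y_nn: "0 \<le> y m i" if "i < n" for m i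
    unfolding y_def using S_pos[of m] p_nn[OF that] by (intro divide_nonneg_pos sum_nonneg) auto
  have y_sum: "(\<Sum>i = 0..<n. y m i) = 1" for m
  proof -
    have "(\<Sum>i = 0..<n. y m i) = (\<Sum>i = 0..<n. \<Sum>k<K m. p k i) / S m"
      by (simp add: y_def sum_divide_distrib)
    also have "(\<Sum>i = 0..<n. \<Sum>k<K m. p k i) = S m"
      unfolding S_def a_def by (rule sum.swap)
    finally show ?thesis using S_pos[of m] by simp
  qed
  have "y m i \<le> 1" if "i < n" for m i
    using member_le_sum[of i "{0..<n}" "y m"] that y_nn y_sum[of m] by auto
  then have "Bseq (\<lambda>m. y m i)" if "i < n" for i
    using that y_nn by (intro BseqI'[of _ 1]) auto
  from convergent_subseq_finite[of n y, OF this] obtain l r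
    where r: "strict_mono r" and l: "\<And>i. i < n \<Longrightarrow> (\<lambda>m. y (r m) i) \<longlonglongrightarrow> l i" by blast
  \<comment> \<open>Applying \<open>C\<close> shifts the summed iterates by one index, so the
    difference telescopes to its end terms, which the choice of \<open>K m\<close> makes small
    relative to \<open>S m\<close>.\<close>
  have almost: "\<bar>(\<Sum>j = 0..<n. C $$ (i, j) * y m j) - y m i\<bar> \<le> inverse (real (Suc m))" if "i < n" for m i
  proof -
    have "(\<Sum>j = 0..<n. C $$ (i, j) * y m j) = (\<Sum>j = 0..<n. \<Sum>k<K m. C $$ (i, j) * p k j) / S m"
      by (simp add: y_def sum_divide_distrib sum_distrib_left)
    also have "(\<Sum>j = 0..<n. \<Sum>k<K m. C $$ (i, j) * p k j) = (\<Sum>k<K m. p (Suc k) i)"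
      using that by (subst sum.swap) (simp add: p_Suc)
    finally have "(\<Sum>j = 0..<n. C $$ (i, j) * y m j) - y m i = (\<Sum>k<K m. p (Suc k) i - p k i) / S m"
      by (simp add: y_def sum_subtractf diff_divide_distrib)
    also have "\<dots> = (p (K m) i - u $ i) / S m"
      using that using sum_lessThan_telescope[of "\<lambda>k. p k i" "K m"] by (simp add: p_0)
    finally have eq: "(\<Sum>j = 0..<n. C $$ (i, j) * y m j) - y m i = (p (K m) i - u $ i) / S m" .
    have "p (K m) i - u $ i \<le> inverse (real (Suc m)) * S m"
      using p_le[OF that, of "K m"] u_nn[OF that] K(2)[of m] unfolding S_def by linarith
    then show ?thesis
      unfolding eq using S_pos[of m] p_ge[OF that, of "K m"] by (simp add: pos_divide_le_eq)
  qed
  have fixed: "(\<Sum>j = 0..<n. C $$ (i, j) * l j) = l i" if "i < n" for i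
  proof -
    have "(\<lambda>m. (\<Sum>j = 0..<n. C $$ (i, j) * y (r m) j) - y (r m) i) \<longlonglongrightarrow> (\<Sum>j = 0..<n. C $$ (i, j) * l j) - l i"
      using l that by (intro tendsto_intros) auto
    moreover have "(\<lambda>m. (\<Sum>j = 0..<n. C $$ (i, j) * y (r m) j) - y (r m) i) \<longlonglongrightarrow> 0"
    proof (rule tendsto_0_le[where K = 1])
      show "(\<lambda>m. inverse (real (Suc (r m)))) \<longlonglongrightarrow> 0"
        using LIMSEQ_subseq_LIMSEQ[OF LIMSEQ_inverse_real_of_nat r] by (simp add: o_def)
    qed (use almost[OF that] in \<open>auto intro!: always_eventually\<close>)
    ultimately show ?thesis using LIMSEQ_unique by fastforce
  qed
  have l_nn: "0 \<le> l i" if "i < n" for i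
    using l[OF that] y_nn[OF that] by (intro LIMSEQ_le_const) auto
  have "(\<lambda>m. \<Sum>i = 0..<n. y (r m) i) \<longlonglongrightarrow> (\<Sum>i = 0..<n. l i)"
    using l by (intro tendsto_sum) auto
  then have "1 = (\<Sum>i = 0..<n. l i)"
    unfolding y_sum LIMSEQ_const_iff .
  then have l_sum: "(\<Sum>i = 0..<n. l i) = 1" by simp
  show thesis
  proof (rule that[of "vec n l"])
    show "vec n l \<noteq> 0\<^sub>v n"
    proof
      assume "vec n l = 0\<^sub>v n"
      then have "l i = 0" if "i < n" for i using that by (metis index_vec index_zero_vec(1))
      then show False using l_sum by simp
    qed
    show "C *\<^sub>v vec n l = vec n l"
      using C fixed by (intro eq_vecI) (auto simp: scalar_prod_def)
  qed (use l_nn in auto)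
qed

text \<open>For a complex eigenvector v whose eigenvalue has modulus \<rho>, the triangle inequality
  gives \<rho> |v| \<le> B |v|. After scaling by 1/\<rho>, |v| is the starting vector for
  \<open>fixed_vector_of_subinvariant\<close>.\<close>

lemma perron_eigenvector:
  assumes B: "B \<in> carrier_mat n n" and nn: "nonneg_mat B" and n: "n > 0" and pos: "spec_rad B > 0"
  obtains y where "y \<in> carrier_vec n" "y \<noteq> 0\<^sub>v n" "\<And>i. i < n \<Longrightarrow> 0 \<le> y $ i"
    "B *\<^sub>v y = spec_rad B \<cdot>\<^sub>v y"
proof -
  define \<rho> where "\<rho> = spec_rad B"
  have \<rho>: "\<rho> > 0" using pos by (simp add: \<rho>_def)
  obtain a v where v: "v \<in> carrier_vec n" "v \<noteq> 0\<^sub>v n"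
    and ev: "map_mat complex_of_real B *\<^sub>v v = a \<cdot>\<^sub>v v" and a: "norm a = \<rho>"
    using spec_rad_eigenvector[OF B n] unfolding \<rho>_def by blast
  define C where "C = (1 / \<rho>) \<cdot>\<^sub>m B"
  have C: "C \<in> carrier_mat n n" using B by (simp add: C_def)
  have C_nn: "nonneg_mat C" using nn B \<rho> by (auto simp: nonneg_mat_def C_def)
  have "map_mat complex_of_real C = complex_of_real (1 / \<rho>) \<cdot>\<^sub>m map_mat complex_of_real B"
    by (rule eq_matI) (auto simp: C_def)
  then have "spec_rad C \<le> norm (complex_of_real (1 / \<rho>)) * spec_rad B"
    unfolding spec_rad_def using B n \<rho> spectral_radius_smult_le[of "map_mat complex_of_real B" n "complex_of_real (1 / \<rho>)"]
    by simp
  then have le: "spec_rad C \<le> 1" using \<rho> by (simp add: \<rho>_def[symmetric] norm_divide)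
  define u where "u = vec n (\<lambda>i. norm (v $ i))"
  have u: "u \<in> carrier_vec n" by (simp add: u_def)
  obtain i0 where i0: "i0 < n" "v $ i0 \<noteq> 0" using v by (auto simp: vec_eq_iff)
  then have "u $ i0 \<noteq> 0" by (simp add: u_def)
  then have u_0: "u \<noteq> 0\<^sub>v n" using i0 by auto
  have sub: "u $ i \<le> (C *\<^sub>v u) $ i" if i: "i < n" for i
  proof -
    have "(map_mat complex_of_real B *\<^sub>v v) $ i = (\<Sum>j = 0..<n. complex_of_real (B $$ (i, j)) * v $ j)"
      using B v i by (simp add: scalar_prod_def)
    then have "norm (a * v $ i) = norm (\<Sum>j = 0..<n. complex_of_real (B $$ (i, j)) * v $ j)"
      using i v by (simp add: ev)
    also have "\<dots> \<le> (\<Sum>j = 0..<n. norm (complex_of_real (B $$ (i, j)) * v $ j))"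
      by (rule norm_sum)
    also have "\<dots> = (\<Sum>j = 0..<n. B $$ (i, j) * norm (v $ j))"
      using nn B i by (intro sum.cong) (auto simp: nonneg_mat_def norm_mult)
    also have "\<dots> = \<rho> * (\<Sum>j = 0..<n. C $$ (i, j) * u $ j)"
      using B i \<rho> by (simp add: C_def u_def sum_distrib_left)
    also have "(\<Sum>j = 0..<n. C $$ (i, j) * u $ j) = (C *\<^sub>v u) $ i"
      using C u i by (simp add: scalar_prod_def)
    finally show ?thesis using \<rho> i by (simp add: a norm_mult u_def)
  qed
  obtain y where y: "y \<in> carrier_vec n" "y \<noteq> 0\<^sub>v n" "\<And>i. i < n \<Longrightarrow> 0 \<le> y $ i" and Cy: "C *\<^sub>v y = y"
    using fixed_vector_of_subinvariant[OF C C_nn le u u_0 _ sub] by (auto simp: u_def)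
  have "B *\<^sub>v y = \<rho> \<cdot>\<^sub>v y"
  proof (rule eq_vecI)
    fix i assume "i < dim_vec (\<rho> \<cdot>\<^sub>v y)"
    then have i: "i < n" using y by simp
    have "(B *\<^sub>v y) $ i = \<rho> * (C *\<^sub>v y) $ i"
      using B y i \<rho> by (simp add: C_def)
    then show "(B *\<^sub>v y) $ i = (\<rho> \<cdot>\<^sub>v y) $ i" using y i by (simp add: Cy)
  qed (use B y in auto)
  then show thesis using y that unfolding \<rho>_def by blast
qed

subsection \<open>Comparison of the spectral radii\<close>

lemma nonneg_mult_vec:
  assumes A: "A \<in> carrier_mat m n" and nn: "nonneg_mat A"
    and x: "x \<in> carrier_vec n" "\<And>j. j < n \<Longrightarrow> 0 \<le> x $ j" and i: "i < m"
  shows "0 \<le> (A *\<^sub>v x) $ i"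
proof -
  have "(A *\<^sub>v x) $ i = (\<Sum>j = 0..<n. A $$ (i, j) * x $ j)"
    using A x(1) i by (simp add: scalar_prod_def)
  also have "\<dots> \<ge> 0"
    using nn A i x(2) by (intro sum_nonneg mult_nonneg_nonneg) (auto simp: nonneg_mat_def)
  finally show ?thesis .
qed

text \<open>With \<open>X\<close> and \<open>Y\<close> the pseudoinverses of \<open>U\<close> and \<open>A = U - Z\<close>, the hypothesis \<open>X_eq\<close> says that
  \<open>X\<close> acts as \<open>1 - \<rho>\<close> times \<open>Y\<close> on a Perron vector of \<open>Z X\<close>; nonnegativity of both forces
  \<open>\<rho> < 1\<close>. Type II splittings fit directly, type I splittings after transposition.\<close>

lemma perron_vector_resolvent:
  assumes X: "X \<in> carrier_mat a b" and Y: "Y \<in> carrier_mat a b" and Z: "Z \<in> carrier_mat b a"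
    and X_eq: "X = Y - Y * Z * X"
    and X_nn: "nonneg_mat X" and Y_nn: "nonneg_mat Y" and ZX_nn: "nonneg_mat (Z * X)"
    and b: "b > 0" and pos: "spec_rad (Z * X) > 0"
  obtains z where "spec_rad (Z * X) < 1"
    "z \<in> carrier_vec b" "z \<noteq> 0\<^sub>v b" "\<And>i. i < b \<Longrightarrow> 0 \<le> z $ i"
    "Z *\<^sub>v (Y *\<^sub>v z) = (spec_rad (Z * X) / (1 - spec_rad (Z * X))) \<cdot>\<^sub>v z"
proof -
  define \<rho> where "\<rho> = spec_rad (Z * X)"
  have \<rho>: "\<rho> > 0" using pos by (simp add: \<rho>_def)
  have ZX: "Z * X \<in> carrier_mat b b" using X Z by simp
  obtain z where z: "z \<in> carrier_vec b" "z \<noteq> 0\<^sub>v b" "\<And>i. i < b \<Longrightarrow> 0 \<le> z $ i"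
    and ev: "Z * X *\<^sub>v z = \<rho> \<cdot>\<^sub>v z"
    using perron_eigenvector[OF ZX ZX_nn b pos] unfolding \<rho>_def by blast
  have Xz: "X *\<^sub>v z \<in> carrier_vec a" and Yz: "Y *\<^sub>v z \<in> carrier_vec a"
    using X Y z by auto
  have ZXz: "Z *\<^sub>v (X *\<^sub>v z) = \<rho> \<cdot>\<^sub>v z" using ev X Z z by simp
  have "Y * Z * X *\<^sub>v z = Y *\<^sub>v (Z * X *\<^sub>v z)"
    using X Y Z z ZX by (simp add: assoc_mult_mat[of _ a b _ a _ b] assoc_mult_mat_vec[of Y a b "Z * X" b])
  also have "\<dots> = \<rho> \<cdot>\<^sub>v (Y *\<^sub>v z)" using Y z by (simp add: ev mult_mat_vec)
  finally have YZXz: "Y * Z * X *\<^sub>v z = \<rho> \<cdot>\<^sub>v (Y *\<^sub>v z)" .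
  have "X *\<^sub>v z = Y *\<^sub>v z - Y * Z * X *\<^sub>v z"
    using minus_mult_distrib_mat_vec[of Y a b "Y * Z * X" z] X Y Z z by (subst X_eq) simp
  then have XY: "X *\<^sub>v z = (1 - \<rho>) \<cdot>\<^sub>v (Y *\<^sub>v z)"
    using Yz unfolding YZXz by (intro eq_vecI) (auto simp: algebra_simps)
  \<comment> \<open>X z cannot vanish, because \<open>Z\<close> maps it to the nonzero vector \<rho>
    z.\<close>
  have "\<exists>i<a. (X *\<^sub>v z) $ i \<noteq> 0"
  proof (rule ccontr)
    assume "\<not> ?thesis"
    then have "X *\<^sub>v z = 0\<^sub>v a" using X by (intro eq_vecI) auto
    moreover have "Z *\<^sub>v 0\<^sub>v a = 0\<^sub>v b" using Z by (intro eq_vecI) auto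
    ultimately have "\<rho> \<cdot>\<^sub>v z = 0\<^sub>v b" using ZXz by simp
    then have "z = 0\<^sub>v b" using z(1) \<rho> by (auto simp: vec_eq_iff)
    then show False using z(2) by simp
  qed
  then obtain i where i: "i < a" "(X *\<^sub>v z) $ i \<noteq> 0" by blast
  \<comment> \<open>A positive entry of X z is 1 - \<rho> times a nonnegative entry of Y z, which
    forces \<rho> < 1.\<close>
  then have "0 < (X *\<^sub>v z) $ i"
    using nonneg_mult_vec[OF X X_nn z(1,3), of i] by linarith
  then have "0 < (1 - \<rho>) * (Y *\<^sub>v z) $ i" using i(1) Y by (simp add: XY)
  then have \<rho>1: "\<rho> < 1"
    using nonneg_mult_vec[OF Y Y_nn z(1,3) i(1)] by (auto simp: zero_less_mult_iff)
  have "(1 - \<rho>) \<cdot>\<^sub>v (Z *\<^sub>v (Y *\<^sub>v z)) = \<rho> \<cdot>\<^sub>v z"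
    using ZXz mult_mat_vec[OF Z Yz, of "1 - \<rho>"] by (simp add: XY)
  then have eq: "(1 - \<rho>) * (Z *\<^sub>v (Y *\<^sub>v z)) $ i = \<rho> * z $ i" if "i < b" for i
  proof -
    have "(1 - \<rho>) * (Z *\<^sub>v (Y *\<^sub>v z)) $ i = ((1 - \<rho>) \<cdot>\<^sub>v (Z *\<^sub>v (Y *\<^sub>v z))) $ i"
      using that Z by simp
    then show ?thesis using \<open>(1 - \<rho>) \<cdot>\<^sub>v (Z *\<^sub>v (Y *\<^sub>v z)) = \<rho> \<cdot>\<^sub>v z\<close> that z(1) by simp
  qed
  have "Z *\<^sub>v (Y *\<^sub>v z) = (\<rho> / (1 - \<rho>)) \<cdot>\<^sub>v z"
  proof (rule eq_vecI)
    fix i assume "i < dim_vec ((\<rho> / (1 - \<rho>)) \<cdot>\<^sub>v z)"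
    then have i: "i < b" using z by simp
    show "(Z *\<^sub>v (Y *\<^sub>v z)) $ i = ((\<rho> / (1 - \<rho>)) \<cdot>\<^sub>v z) $ i"
      using eq[OF i] \<rho>1 i z(1) by (simp add: field_simps)
  qed (use Z z in auto)
  then show thesis using that \<rho>1 z unfolding \<rho>_def by blast
qed

text \<open>Type II controls V U^+, whereas the conclusion speaks of U^+ V; the two radii agree by
  commutation since the latter is positive.\<close>

lemma pwr_splitting_II_vector:
  assumes A: "A \<in> carrier_mat m n" and U: "U \<in> carrier_mat m n" and V: "V \<in> carrier_mat m n"
    and split: "pwr_splitting_II A U V" and A_nn: "nonneg_mat (mp_inverse A)"
    and m: "m > 0" and n: "n > 0" and pos: "spec_rad (mp_inverse U * V) > 0"
  obtains z where "spec_rad (mp_inverse U * V) < 1"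
    "z \<in> carrier_vec m" "z \<noteq> 0\<^sub>v m" "\<And>i. i < m \<Longrightarrow> 0 \<le> z $ i"
    "V *\<^sub>v (mp_inverse A *\<^sub>v z) = (spec_rad (mp_inverse U * V) / (1 - spec_rad (mp_inverse U * V))) \<cdot>\<^sub>v z"
proof -
  have ps: "proper_splitting A U V" and U_nn: "nonneg_mat (mp_inverse U)"
    and VU_nn: "nonneg_mat (V * mp_inverse U)"
    using split by (auto simp: pwr_splitting_II_def)
  note cA = mp_inverse(1)[OF A] and cU = mp_inverse(1)[OF U]
  have rad: "spec_rad (V * mp_inverse U) = spec_rad (mp_inverse U * V)"
    by (rule spec_rad_mult_commute[OF cU V n m pos])
  show thesis
    using perron_vector_resolvent[OF cU cA V proper_splitting_resolvent(2)[OF A U V ps] U_nn A_nn VU_nn m]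
      pos that unfolding rad by blast
qed

text \<open>Transposition reverses products, so the first identity of
  \<open>proper_splitting_resolvent\<close> becomes \<open>X_eq\<close>, and the radius transfers by
  \<open>spec_rad_transpose\<close>. The vector obtained is a left eigenvector of A^+ V.\<close>

lemma pwr_splitting_I_vector:
  assumes A: "A \<in> carrier_mat m n" and U: "U \<in> carrier_mat m n" and V: "V \<in> carrier_mat m n"
    and split: "pwr_splitting_I A U V" and A_nn: "nonneg_mat (mp_inverse A)"
    and n: "n > 0" and pos: "spec_rad (mp_inverse U * V) > 0"
  obtains w where "spec_rad (mp_inverse U * V) < 1"
    "w \<in> carrier_vec n" "w \<noteq> 0\<^sub>v n" "\<And>i. i < n \<Longrightarrow> 0 \<le> w $ i"
    "transpose_mat V *\<^sub>v (transpose_mat (mp_inverse A) *\<^sub>v w) =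
      (spec_rad (mp_inverse U * V) / (1 - spec_rad (mp_inverse U * V))) \<cdot>\<^sub>v w"
proof -
  have ps: "proper_splitting A U V" and U_nn: "nonneg_mat (mp_inverse U)"
    and UV_nn: "nonneg_mat (mp_inverse U * V)"
    using split by (auto simp: pwr_splitting_I_def)
  note cA = mp_inverse(1)[OF A] and cU = mp_inverse(1)[OF U]
  let ?X = "transpose_mat (mp_inverse U)" and ?Y = "transpose_mat (mp_inverse A)" and ?Z = "transpose_mat V"
  have X: "?X \<in> carrier_mat m n" and Y: "?Y \<in> carrier_mat m n" and Z: "?Z \<in> carrier_mat n m"
    using cA cU V by auto
  have UV: "mp_inverse U * V \<in> carrier_mat n n" using cU V by simp
  have ZX: "?Z * ?X = transpose_mat (mp_inverse U * V)"
    using cU V by (simp add: transpose_mult[of _ n m _ n])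
  have rad: "spec_rad (?Z * ?X) = spec_rad (mp_inverse U * V)"
    unfolding ZX by (rule spec_rad_transpose[OF UV])
  have "?X = transpose_mat (mp_inverse A - mp_inverse U * V * mp_inverse A)"
    using proper_splitting_resolvent(1)[OF A U V ps] by simp
  also have "\<dots> = ?Y - transpose_mat (mp_inverse U * V * mp_inverse A)"
    using cA UV by (intro transpose_minus) auto
  also have "transpose_mat (mp_inverse U * V * mp_inverse A) = ?Y * ?Z * ?X"
    using transpose_mult[OF UV cA] assoc_mult_mat[OF Y Z X] by (simp only: ZX)
  finally have X_eq: "?X = ?Y - ?Y * ?Z * ?X" .
  have nn: "nonneg_mat ?X" "nonneg_mat ?Y" "nonneg_mat (?Z * ?X)"
    using U_nn A_nn UV_nn unfolding ZX by (auto simp: nonneg_mat_def)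
  show thesis
    using perron_vector_resolvent[OF X Y Z X_eq nn n] pos that unfolding rad by blast
qed

section \<open>Pairing of left and right Perron vectors\<close>

lemma bilinear_strict_mono:
  assumes P: "P \<in> carrier_mat n m" and Q: "Q \<in> carrier_mat n m" and PQ: "pos_mat (Q - P)"
    and w: "w \<in> carrier_vec n" "w \<noteq> 0\<^sub>v n" "\<And>i. i < n \<Longrightarrow> 0 \<le> w $ i"
    and z: "z \<in> carrier_vec m" "z \<noteq> 0\<^sub>v m" "\<And>i. i < m \<Longrightarrow> 0 \<le> z $ i"
  shows "w \<bullet> (P *\<^sub>v z) < w \<bullet> (Q *\<^sub>v z)"
proof -
  obtain i0 where i0: "i0 < n" "w $ i0 \<noteq> 0" using w by (auto simp: vec_eq_iff)
  obtain j0 where j0: "j0 < m" "z $ j0 \<noteq> 0" using z by (auto simp: vec_eq_iff)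
  have w0: "w $ i0 > 0" and z0: "z $ j0 > 0" using w(3)[OF i0(1)] z(3)[OF j0(1)] i0 j0 by auto
  have entry: "P $$ (i, j) < Q $$ (i, j)" if "i < n" "j < m" for i j
    using PQ P Q that by (auto simp: pos_mat_def)
  \<comment> \<open>One positive entry of \<open>z\<close> makes every row strict; one positive
    entry of \<open>w\<close> then makes the pairing strict.\<close>
  have row: "(P *\<^sub>v z) $ i < (Q *\<^sub>v z) $ i" if i: "i < n" for i
  proof -
    have "(\<Sum>j = 0..<m. P $$ (i, j) * z $ j) < (\<Sum>j = 0..<m. Q $$ (i, j) * z $ j)"
    proof (rule sum_strict_mono_ex1)
      show "\<forall>j\<in>{0..<m}. P $$ (i, j) * z $ j \<le> Q $$ (i, j) * z $ j"
        using entry[OF i] z(3) by (intro ballI mult_right_mono) (auto intro: less_imp_le)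
      show "\<exists>j\<in>{0..<m}. P $$ (i, j) * z $ j < Q $$ (i, j) * z $ j"
        using entry[OF i j0(1)] z0 j0(1) by (intro bexI[of _ j0]) auto
    qed simp
    then show ?thesis using P Q z(1) i by (simp add: scalar_prod_def)
  qed
  have "(\<Sum>i = 0..<n. w $ i * (P *\<^sub>v z) $ i) < (\<Sum>i = 0..<n. w $ i * (Q *\<^sub>v z) $ i)"
  proof (rule sum_strict_mono_ex1)
    show "\<forall>i\<in>{0..<n}. w $ i * (P *\<^sub>v z) $ i \<le> w $ i * (Q *\<^sub>v z) $ i"
      using row w(3) by (intro ballI mult_left_mono) (auto intro: less_imp_le)
    show "\<exists>i\<in>{0..<n}. w $ i * (P *\<^sub>v z) $ i < w $ i * (Q *\<^sub>v z) $ i"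
      using row[OF i0(1)] w0 i0(1) by (intro bexI[of _ i0]) auto
  qed simp
  then show ?thesis using P Q by (simp add: scalar_prod_def)
qed

text \<open>Both sides are the number w^T P V Q z, with \<open>V\<close> absorbed into the left
  vector or into the right one.\<close>

lemma eigenvector_pairing:
  fixes P Q V :: "real mat"
  assumes P: "P \<in> carrier_mat n m" and Q: "Q \<in> carrier_mat n m" and V: "V \<in> carrier_mat m n"
    and w: "w \<in> carrier_vec n" and z: "z \<in> carrier_vec m"
    and left: "transpose_mat V *\<^sub>v (transpose_mat P *\<^sub>v w) = \<alpha> \<cdot>\<^sub>v w"
    and right: "V *\<^sub>v (Q *\<^sub>v z) = \<beta> \<cdot>\<^sub>v z"
  shows "\<alpha> * (w \<bullet> (Q *\<^sub>v z)) = \<beta> * (w \<bullet> (P *\<^sub>v z))"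
proof -
  have Qz: "Q *\<^sub>v z \<in> carrier_vec n" and Pw: "transpose_mat P *\<^sub>v w \<in> carrier_vec m"
    using P Q w z by auto
  have "\<alpha> * (w \<bullet> (Q *\<^sub>v z)) = (transpose_mat V *\<^sub>v (transpose_mat P *\<^sub>v w)) \<bullet> (Q *\<^sub>v z)"
    using w Qz by (simp add: left)
  also have "\<dots> = (transpose_mat P *\<^sub>v w) \<bullet> (V *\<^sub>v (Q *\<^sub>v z))"
    by (rule transpose_vec_mult_scalar[OF V Qz Pw])
  also have "\<dots> = w \<bullet> (P *\<^sub>v (\<beta> \<cdot>\<^sub>v z))"
    unfolding right using P w z by (intro transpose_vec_mult_scalar) auto
  also have "\<dots> = \<beta> * (w \<bullet> (P *\<^sub>v z))"
    using P w z by (simp add: mult_mat_vec)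
  finally show ?thesis .
qed

lemma ratio_less_cancel:
  fixes a b :: real
  assumes "a < 1" "b < 1" "a / (1 - a) < b / (1 - b)"
  shows "a < b"
proof -
  have "a * (1 - b) < b * (1 - a)"
    using assms by (simp add: pos_divide_less_eq pos_less_divide_eq)
  then show ?thesis by (simp add: algebra_simps)
qed

text \<open>As \<open>x\<close> may be zero, division by it is replaced by contradiction: b \<le> a
  would give b x \<le> a x < a y.\<close>

lemma scaled_less_imp_less:
  fixes a b x y :: real
  assumes "a * y = b * x" "x < y" "0 \<le> x" "0 < a"
  shows "a < b"
proof (rule ccontr)
  assume "\<not> a < b"
  then have "b * x \<le> a * x" using assms by (intro mult_right_mono) auto
  also have "\<dots> < a * y" using mult_strict_left_mono[OF assms(2,4)] .
  finally show False using assms by simp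
qed

theorem theorem3p11:
  fixes m n :: nat and A1 A2 U1 U2 V :: "real mat"
  assumes dims: "A1 \<in> carrier_mat m n" "A2 \<in> carrier_mat m n"
    "U1 \<in> carrier_mat m n" "U2 \<in> carrier_mat m n" "V \<in> carrier_mat m n"
    and types: "(pwr_splitting_I A1 U1 V \<and> pwr_splitting_II A2 U2 V) \<or>
                (pwr_splitting_II A1 U1 V \<and> pwr_splitting_I A2 U2 V)"
    and rho1: "spec_rad (mp_inverse U1 * V) > 0"
    and rho2: "spec_rad (mp_inverse U2 * V) > 0"
    and V0: "V \<noteq> 0\<^sub>m m n"
    and A1nn: "nonneg_mat (mp_inverse A1)"
    and A21: "pos_mat (mp_inverse A2 - mp_inverse A1)"
  shows "spec_rad (mp_inverse U1 * V) < spec_rad (mp_inverse U2 * V) \<and>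
         spec_rad (mp_inverse U2 * V) < 1"
proof -
  let ?P = "mp_inverse A1" and ?Q = "mp_inverse A2"
  let ?r = "spec_rad (mp_inverse U1 * V)" and ?s = "spec_rad (mp_inverse U2 * V)"
  have P: "?P \<in> carrier_mat n m" and Q: "?Q \<in> carrier_mat n m"
    using dims by (auto intro: mp_inverse(1))
  \<comment> \<open>A nonzero \<open>V\<close> excludes empty dimensions, where no eigenvector
    attains the spectral radius.\<close>
  have m: "m > 0" and n: "n > 0"
    using V0 dims(5) by (auto intro!: gr0I)
  have A2nn: "nonneg_mat ?Q"
    using A1nn A21 P Q unfolding nonneg_mat_def pos_mat_def by fastforce
  have pairing_nn: "0 \<le> w \<bullet> (?P *\<^sub>v z)"
    if "\<And>i. i < n \<Longrightarrow> 0 \<le> w $ i" "z \<in> carrier_vec m" "\<And>i. i < m \<Longrightarrow> 0 \<le> z $ i" for w z :: "real vec"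
    unfolding scalar_prod_def using that P nonneg_mult_vec[OF P A1nn]
    by (intro sum_nonneg mult_nonneg_nonneg) auto
  from types show ?thesis
  proof (elim disjE conjE)
    assume I: "pwr_splitting_I A1 U1 V" and II: "pwr_splitting_II A2 U2 V"
    obtain w where r1: "?r < 1" and w: "w \<in> carrier_vec n" "w \<noteq> 0\<^sub>v n" "\<And>i. i < n \<Longrightarrow> 0 \<le> w $ i"
      and left: "transpose_mat V *\<^sub>v (transpose_mat ?P *\<^sub>v w) = (?r / (1 - ?r)) \<cdot>\<^sub>v w"
      using pwr_splitting_I_vector[OF dims(1,3,5) I A1nn n rho1] by blast
    obtain z where s1: "?s < 1" and z: "z \<in> carrier_vec m" "z \<noteq> 0\<^sub>v m" "\<And>i. i < m \<Longrightarrow> 0 \<le> z $ i"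
      and right: "V *\<^sub>v (?Q *\<^sub>v z) = (?s / (1 - ?s)) \<cdot>\<^sub>v z"
      using pwr_splitting_II_vector[OF dims(2,4,5) II A2nn m n rho2] by blast
    have "0 < ?r / (1 - ?r)" using rho1 r1 by (intro divide_pos_pos) auto
    \<comment> \<open>Here x = w^T A1^+ z and y = w^T A2^+ z in
      \<open>scaled_less_imp_less\<close>.\<close>
    then have "?r / (1 - ?r) < ?s / (1 - ?s)"
      using eigenvector_pairing[OF P Q dims(5) w(1) z(1) left right]
        bilinear_strict_mono[OF P Q A21 w z] pairing_nn[OF w(3) z(1,3)]
      by (intro scaled_less_imp_less[where a = "?r / (1 - ?r)"])
    then show ?thesis using ratio_less_cancel[OF r1 s1] s1 by simp
  next
    assume II: "pwr_splitting_II A1 U1 V" and I: "pwr_splitting_I A2 U2 V"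
    obtain w where s1: "?s < 1" and w: "w \<in> carrier_vec n" "w \<noteq> 0\<^sub>v n" "\<And>i. i < n \<Longrightarrow> 0 \<le> w $ i"
      and left: "transpose_mat V *\<^sub>v (transpose_mat ?Q *\<^sub>v w) = (?s / (1 - ?s)) \<cdot>\<^sub>v w"
      using pwr_splitting_I_vector[OF dims(2,4,5) I A2nn n rho2] by blast
    obtain z where r1: "?r < 1" and z: "z \<in> carrier_vec m" "z \<noteq> 0\<^sub>v m" "\<And>i. i < m \<Longrightarrow> 0 \<le> z $ i"
      and right: "V *\<^sub>v (?P *\<^sub>v z) = (?r / (1 - ?r)) \<cdot>\<^sub>v z"
      using pwr_splitting_II_vector[OF dims(1,3,5) II A1nn m n rho1] by blast
    have "0 < ?r / (1 - ?r)" using rho1 r1 by (intro divide_pos_pos) auto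
    \<comment> \<open>The left vector now belongs to A2 and the right one to A1, so the pairing
      identity arrives with its sides exchanged.\<close>
    then have "?r / (1 - ?r) < ?s / (1 - ?s)"
      using eigenvector_pairing[OF Q P dims(5) w(1) z(1) left right, symmetric]
        bilinear_strict_mono[OF P Q A21 w z] pairing_nn[OF w(3) z(1,3)]
      by (intro scaled_less_imp_less[where a = "?r / (1 - ?r)"])
    then show ?thesis using ratio_less_cancel[OF r1 s1] s1 by simp
  qed
qed

end
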